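(* For any nonnegative integer $n$, $F_0(n)$ equals the number of partitions of $n$ in two colors (red and blue), with optional overlines, in which: the odd parts and the parts $\equiv 0 \pmod{16}$ may appear only in blue color; the parts $\equiv 6,10 \pmod{16}$ may appear in red and in blue, with the first blue occurrence of each such part optionally overlined; and all other even parts may appear in either color (with no overlines on any parts other than those just described).
   Context: A two-color partition of $n$ is a finite multiset of positive integers (parts), each part colored red or blue, whose sum is $n$ (the same integer in two different colors counts as two different kinds of parts; repetitions are allowed). For a nonnegative integer $n$, $\mathcal{F}(n)$ is the set of two-color partitions of $n$ in which even parts may occur only in blue color (odd parts may occur in either color). $F_0(n)$ is the number of partitions in $\mathcal{F}(n)$ in which the number of red odd parts (counted with multiplicity) is even. "The first blue occurrence of a part is optionally overlined" means that, for each part size $m$ of the indicated type that occurs in blue, there are two distinct choices: either exactly one of the blue copies of $m$ is overlined (the first one), or none is. *)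

theory Defs
  imports "HOL-Library.Multiset"
begin

datatype color = Red | Blue

text \<open>A part is a pair of its size and its color.\<close>

definition two_color_partition :: "nat \<Rightarrow> (nat \<times> color) multiset \<Rightarrow> bool" where
  "two_color_partition n P \<longleftrightarrow>
     (\<forall>x \<in># P. fst x > 0) \<and> (\<Sum>x \<in># P. fst x) = n"

definition F_set :: "nat \<Rightarrow> (nat \<times> color) multiset set" where
  "F_set n = {P. two_color_partition n P \<and> (\<forall>m c. (m, c) \<in># P \<and> even m \<longrightarrow> c = Blue)}"

definition num_red_odd :: "(nat \<times> color) multiset \<Rightarrow> nat" where
  "num_red_odd P = size {#x \<in># P. snd x = Red \<and> odd (fst x)#}"

definition F0 :: "nat \<Rightarrow> nat" where
  "F0 n = card {P \<in> F_set n. even (num_red_odd P)}"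

text \<open>
  Since at most the first blue copy of a part size can be overlined, an overlining of \<open>P\<close> is
  determined by the set \<open>S\<close> of those part sizes whose first blue copy is overlined.
  Only sizes that actually occur in blue may belong to \<open>S\<close>.
\<close>

definition overlined_partitions :: "nat \<Rightarrow> ((nat \<times> color) multiset \<times> nat set) set" where
  "overlined_partitions n =
     {(P, S). two_color_partition n P \<and>
        (\<forall>m c. (m, c) \<in># P \<and> (odd m \<or> m mod 16 = 0) \<longrightarrow> c = Blue) \<and>
        S \<subseteq> {m. (m, Blue) \<in># P \<and> m mod 16 \<in> {6, 10}}}"

end

theory Submission
  imports Defs "HOL-Computational_Algebra.Formal_Power_Series"
begin

text \<open>
  Counting the partitions in \<open>\<F>(n)\<close> once with weight \<open>1\<close> and once with the sign
  \<open>(-1)\<^bsup>r\<^esup>\<close>, where \<open>r\<close> is the number of red odd parts, gives the generating function of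
  \<open>2 F\<^sub>0(n)\<close>. The blue parts contribute \<open>1 / (q; q)\<^sub>\<infinity>\<close> to both counts, so that
  \<open>2 \<Sum> F\<^sub>0(n) q\<^sup>n = (1 / (q; q)\<^sub>\<infinity>) (1 / (q; q\<^sup>2)\<^sub>\<infinity> + 1 / (-q; q\<^sup>2)\<^sub>\<infinity>)\<close>.

  On the common denominator \<open>(q\<^sup>2; q\<^sup>4)\<^sub>\<infinity>\<close>, the bracket is twice the even part of \<open>(-q; q\<^sup>2)\<^sub>\<infinity>\<close>
  divided by \<open>(q\<^sup>2; q\<^sup>4)\<^sub>\<infinity>\<close>. By the Jacobi triple product,
  \<open>(-q; q\<^sup>2)\<^sub>\<infinity> (q\<^sup>4; q\<^sup>4)\<^sub>\<infinity> = f(q, q\<^sup>3)\<close>, where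
  \<open>f(a, b) = (\<Sum>j\<in>\<int>. a\<^bsup>j(j+1)/2\<^esup> b\<^bsup>j(j-1)/2\<^esup>)\<close>. The even powers of \<open>q\<close> in \<open>f(q, q\<^sup>3)\<close> come
  from the even \<open>j\<close>, and these terms form \<open>f(q\<^sup>6, q\<^sup>1\<^sup>0)\<close>. A second use of the triple product,
  now backwards, gives
  \<open>\<Sum> F\<^sub>0(n) q\<^sup>n = (-q\<^sup>6; q\<^sup>1\<^sup>6)\<^sub>\<infinity> (-q\<^sup>1\<^sup>0; q\<^sup>1\<^sup>6)\<^sub>\<infinity> (q\<^sup>1\<^sup>6; q\<^sup>1\<^sup>6)\<^sub>\<infinity> / ((q; q)\<^sub>\<infinity> (q\<^sup>2; q\<^sup>2)\<^sub>\<infinity>)\<close>.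
  Here \<open>1 / (q; q)\<^sub>\<infinity>\<close> stands for the blue parts, \<open>(q\<^sup>1\<^sup>6; q\<^sup>1\<^sup>6)\<^sub>\<infinity> / (q\<^sup>2; q\<^sup>2)\<^sub>\<infinity>\<close> for the red
  parts, which are even and not divisible by \<open>16\<close>, and the two remaining factors for the
  overlined blue parts, which can be detached because no size has more than one of them
  (\<open>overlined_partitions_bij\<close>).

  Fixing \<open>n\<close>, all of this is carried out with finite products of formal power series modulo
  \<open>X\<^bsup>n+1\<^esup>\<close>. The triple product comes from a finite version with Gaussian binomial
  coefficients (\<open>finite_jacobi_triple_product\<close>), and the theta function argument is
  \<open>theta_even_part_mod\<close>.
\<close>

section \<open>Gaussian binomial coefficients\<close>

text \<open>
  The Gaussian binomial coefficient, given by its Pascal recurrence so that it is a polynomial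
  in \<open>p\<close> over any commutative ring and no quotient has to be formed.
\<close>

fun qbinom :: "'a::comm_ring_1 \<Rightarrow> nat \<Rightarrow> nat \<Rightarrow> 'a" where
  "qbinom p n 0 = 1"
| "qbinom p 0 (Suc k) = 0"
| "qbinom p (Suc n) (Suc k) = qbinom p n k + p ^ Suc k * qbinom p n (Suc k)"

lemma qbinom_eq_0: "n < k \<Longrightarrow> qbinom p n k = 0"
  by (induction p n k rule: qbinom.induct) auto

text \<open>
  The ratio of neighbouring Gaussian binomials, with denominators cleared. It turns the defining
  Pascal recurrence into the mirrored one below, and iterating it gives the factorial formula.
\<close>

lemma qbinom_Suc_right:
  "k \<le> n \<Longrightarrow> (1 - p ^ Suc k) * qbinom p n (Suc k) = (1 - p ^ (n - k)) * qbinom p n k"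
proof (induction n arbitrary: k)
  case 0
  then show ?case by simp
next
  case (Suc n)
  show ?case
  proof (cases k)
    case 0
    have "(1 - p) * qbinom p n (Suc 0) = 1 - p ^ n"
      using Suc.IH[of 0] by simp
    moreover have "(1 - p) * qbinom p (Suc n) (Suc 0) = 1 - p + p * ((1 - p) * qbinom p n (Suc 0))"
      by (simp add: algebra_simps)
    ultimately have "(1 - p) * qbinom p (Suc n) (Suc 0) = 1 - p + p * (1 - p ^ n)"
      by (simp only:)
    then show ?thesis
      using 0 by (simp add: algebra_simps)
  next
    case (Suc l)
    show ?thesis
    proof (cases "l = n")
      case True
      then show ?thesis
        using Suc by (simp add: qbinom_eq_0)
    next
      case False
      define r where "r = n - Suc l"
      have n: "n = Suc l + r"
        using False Suc.prems Suc r_def by simp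
      have 1: "(1 - p ^ Suc (Suc l)) * qbinom p n (Suc (Suc l)) = (1 - p ^ r) * qbinom p n (Suc l)"
        using Suc.IH[of "Suc l"] n by simp
      have 2: "(1 - p ^ Suc l) * qbinom p n (Suc l) = (1 - p ^ Suc r) * qbinom p n l"
        using Suc.IH[of l] n by simp
      have "(1 - p ^ Suc (Suc l)) * qbinom p (Suc n) (Suc (Suc l))
          = (1 - p ^ Suc (Suc l)) * qbinom p n (Suc l)
            + p ^ Suc (Suc l) * ((1 - p ^ Suc (Suc l)) * qbinom p n (Suc (Suc l)))"
        by (simp add: algebra_simps)
      also have "\<dots> = (1 - p ^ Suc l) * qbinom p n (Suc l)
            + p ^ Suc l * (1 - p ^ Suc r) * qbinom p n (Suc l)"
        unfolding 1 by (simp add: algebra_simps)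
      also have "\<dots> = (1 - p ^ Suc r) * qbinom p (Suc n) (Suc l)"
        unfolding 2 by (simp add: algebra_simps)
      finally show ?thesis
        using Suc n by simp
    qed
  qed
qed

lemma qbinom_Suc_Suc':
  assumes "k \<le> n"
  shows "qbinom p (Suc n) (Suc k) = qbinom p n (Suc k) + p ^ (n - k) * qbinom p n k"
  using qbinom_Suc_right[OF assms, of p] by (simp add: algebra_simps)

lemma qbinom_mult_qfact:
  "k \<le> n \<Longrightarrow> qbinom p n k * (\<Prod>i=1..k. 1 - p ^ i) = (\<Prod>i<k. 1 - p ^ (n - i))"
proof (induction k)
  case (Suc k)
  have "qbinom p n (Suc k) * (\<Prod>i=1..Suc k. 1 - p ^ i)
      = (1 - p ^ Suc k) * qbinom p n (Suc k) * (\<Prod>i=1..k. 1 - p ^ i)"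
    by (simp add: algebra_simps)
  also have "\<dots> = (1 - p ^ (n - k)) * (qbinom p n k * (\<Prod>i=1..k. 1 - p ^ i))"
    using Suc.prems by (subst qbinom_Suc_right) (simp_all only: mult.assoc Suc_leD)
  finally show ?case
    using Suc by (simp add: mult.commute)
qed simp

section \<open>The finite Jacobi triple product\<close>

text \<open>
  The triangular number \<open>j (j + 1) / 2\<close>, a natural number also for negative \<open>j\<close>.
\<close>

definition tri :: "int \<Rightarrow> nat" where
  "tri j = nat (j * (j + 1) div 2)"

lemma tri_eq_iff: "tri j = n \<longleftrightarrow> j * (j + 1) = 2 * int n"
proof -
  have "even (j * (j + 1))" by auto
  moreover have "0 \<le> j * (j + 1)"
    by (cases "0 \<le> j") (simp_all add: mult_nonpos_nonpos)
  ultimately show ?thesis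
    unfolding tri_def by auto
qed

lemma two_tri: "2 * int (tri j) = j * (j + 1)"
  using tri_eq_iff[of j "tri j"] by simp

text \<open>
  The general term of Ramanujan's theta function
  \<open>f(a, b) = (\<Sum>j\<in>\<int>. a\<^bsup>j(j+1)/2\<^esup> b\<^bsup>j(j-1)/2\<^esup>)\<close>.
\<close>

definition theta_term :: "'a::comm_ring_1 \<Rightarrow> 'a \<Rightarrow> int \<Rightarrow> 'a" where
  "theta_term a b j = a ^ tri j * b ^ tri (j - 1)"

text \<open>
  In a field this is \<open>b \<theta>\<^sub>j\<^sub>+\<^sub>1 = (a b)\<^bsup>j+1\<^esup> \<theta>\<^sub>j\<close>. The factor \<open>(a b)\<^bsup>n\<^esup>\<close> keeps the exponent on the
  right nonnegative, and it is the factor that occurs in the finite product.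
\<close>

lemma theta_term_Suc:
  assumes "int k = j + 1 + int n"
  shows "b * (a * b) ^ n * theta_term a b (j + 1) = (a * b) ^ k * theta_term a b j"
proof -
  have "int (n + tri (j + 1)) = int (k + tri j)"
    using two_tri[of "j + 1"] two_tri[of j] assms by (simp add: algebra_simps)
  moreover have "int (Suc n + tri j) = int (k + tri (j - 1))"
    using two_tri[of "j - 1"] two_tri[of j] assms by (simp add: algebra_simps)
  ultimately have *: "n + tri (j + 1) = k + tri j" "Suc n + tri j = k + tri (j - 1)"
    by linarith+
  have "b * (a * b) ^ n * theta_term a b (j + 1) = a ^ (n + tri (j + 1)) * b ^ (Suc n + tri j)"
    by (simp add: theta_term_def power_mult_distrib power_add algebra_simps)
  also have "\<dots> = (a * b) ^ k * theta_term a b j"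
    unfolding * by (simp add: theta_term_def power_mult_distrib power_add algebra_simps)
  finally show ?thesis .
qed

lemma theta_term_Suc_nat:
  "theta_term a b (int (Suc k)) = a * (a * b) ^ k * theta_term a b (int k)"
proof -
  have *: "tri (1 + int k) = Suc k + tri (int k)" "tri (int k) = k + tri (int k - 1)"
    using two_tri[of "1 + int k"] two_tri[of "int k"] two_tri[of "int k - 1"]
    by (simp_all add: algebra_simps tri_eq_iff)
  have "theta_term a b (int (Suc k)) = a ^ (Suc k + tri (int k)) * b ^ tri (int k)"
    by (simp add: theta_term_def *(1) del: power_Suc)
  also have "b ^ tri (int k) = b ^ k * b ^ tri (int k - 1)"
    by (simp flip: *(2) power_add)
  finally show ?thesis
    by (simp add: theta_term_def power_mult_distrib power_add algebra_simps)
qed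

lemma theta_term_0 [simp]: "theta_term a b 0 = 1"
proof -
  have "tri 0 = 0" "tri (-1) = 0" by (simp_all add: tri_eq_iff)
  then show ?thesis by (simp add: theta_term_def)
qed

text \<open>
  The case of the finite triple product without factors in \<open>b\<close>. Passing from \<open>m\<close> to \<open>m + 1\<close>
  multiplies by \<open>1 + a (a b)\<^bsup>m\<^esup>\<close>, and the second summand supplies the second term of the
  mirrored Pascal recurrence.
\<close>

lemma q_binomial_theorem:
  fixes a b :: "'a::comm_ring_1"
  shows "(\<Prod>i<m. 1 + a * (a * b) ^ i)
    = (\<Sum>k\<le>m. theta_term a b (int k) * qbinom (a * b) m k)"
proof (induction m)
  case (Suc m)
  define p where "p = a * b"
  define \<theta> where "\<theta> k = theta_term a b (int k)" for k
  have step: "\<theta> (Suc k) * qbinom p (Suc m) (Suc k)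
      = \<theta> (Suc k) * qbinom p m (Suc k) + a * p ^ m * (\<theta> k * qbinom p m k)"
    if "k \<le> m" for k
  proof -
    have "p ^ m = p ^ k * p ^ (m - k)"
      using that by (simp flip: power_add)
    then show ?thesis
      unfolding qbinom_Suc_Suc'[OF that] \<theta>_def theta_term_Suc_nat p_def
      by (simp add: algebra_simps)
  qed
  have "(\<Sum>k\<le>Suc m. \<theta> k * qbinom p (Suc m) k)
      = (\<theta> 0 + (\<Sum>k\<le>m. \<theta> (Suc k) * qbinom p m (Suc k)))
        + a * p ^ m * (\<Sum>k\<le>m. \<theta> k * qbinom p m k)"
    unfolding sum.atMost_Suc_shift
    by (simp add: step sum.distrib sum_distrib_left del: qbinom.simps(3))
  also have "\<theta> 0 + (\<Sum>k\<le>m. \<theta> (Suc k) * qbinom p m (Suc k)) = (\<Sum>k\<le>Suc m. \<theta> k * qbinom p m k)"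
    unfolding sum.atMost_Suc_shift by simp
  also have "\<dots> = (\<Sum>k\<le>m. \<theta> k * qbinom p m k)"
    by (simp add: qbinom_eq_0)
  finally show ?case
    using Suc unfolding p_def \<theta>_def by (simp add: algebra_simps)
qed simp

text \<open>
  Both products are built up one factor at a time, so that each step is a single Pascal
  recurrence and no negative power of \<open>a\<close> or \<open>b\<close> is needed. The index shift by \<open>n\<close> places the
  term with \<open>j = 0\<close> at \<open>k = n\<close>.
\<close>

lemma finite_jacobi_triple_product:
  fixes a b :: "'a::comm_ring_1"
  shows "(\<Prod>i<m. 1 + a * (a * b) ^ i) * (\<Prod>i<n. 1 + b * (a * b) ^ i)
    = (\<Sum>k\<le>m + n. theta_term a b (int k - int n) * qbinom (a * b) (m + n) k)"
proof (induction n)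
  case 0
  then show ?case by (simp add: q_binomial_theorem)
next
  case (Suc n)
  define p where "p = a * b"
  define L where "L = m + n"
  define \<theta> where "\<theta> k = theta_term a b (int k - int n)" for k
  define \<theta>' where "\<theta>' k = theta_term a b (int k - int (Suc n))" for k
  have shift: "\<theta>' (Suc k) = \<theta> k" for k
    by (simp add: \<theta>_def \<theta>'_def)
  have step: "p ^ k * \<theta>' k = b * p ^ n * \<theta> k" for k
    using theta_term_Suc[of k "int k - int (Suc n)" n b a]
    by (simp add: \<theta>_def \<theta>'_def p_def)
  have "(\<Sum>k\<le>Suc L. \<theta>' k * qbinom p (Suc L) k)
      = (\<Sum>k\<le>L. \<theta> k * qbinom p L k)
        + (\<theta>' 0 + (\<Sum>k\<le>L. p ^ Suc k * \<theta>' (Suc k) * qbinom p L (Suc k)))"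
    unfolding sum.atMost_Suc_shift
    by (simp add: shift sum.distrib algebra_simps)
  also have "\<theta>' 0 + (\<Sum>k\<le>L. p ^ Suc k * \<theta>' (Suc k) * qbinom p L (Suc k))
      = (\<Sum>k\<le>Suc L. p ^ k * \<theta>' k * qbinom p L k)"
    unfolding sum.atMost_Suc_shift by simp
  also have "\<dots> = b * p ^ n * (\<Sum>k\<le>L. \<theta> k * qbinom p L k)"
    by (simp add: qbinom_eq_0 step sum_distrib_left mult.assoc)
  finally show ?case
    using Suc unfolding p_def \<theta>_def \<theta>'_def L_def by (simp add: algebra_simps)
qed

section \<open>Congruence of power series modulo a power of the variable\<close>

text \<open>
  Congruence modulo \<open>X\<^bsup>D+1\<^esup>\<close>. It makes infinite products unnecessary: modulo a power of
  \<open>X\<close>, all sufficiently long finite products agree.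
\<close>

definition fps_cong :: "nat \<Rightarrow> 'a::comm_ring_1 fps \<Rightarrow> 'a fps \<Rightarrow> bool" where
  "fps_cong D f g \<longleftrightarrow> (\<forall>k\<le>D. fps_nth f k = fps_nth g k)"

lemma fps_cong_refl [simp]: "fps_cong D f f"
  by (simp add: fps_cong_def)

lemma fps_cong_sym: "fps_cong D f g \<Longrightarrow> fps_cong D g f"
  by (simp add: fps_cong_def)

lemma fps_cong_trans [trans]: "fps_cong D f g \<Longrightarrow> fps_cong D g h \<Longrightarrow> fps_cong D f h"
  by (simp add: fps_cong_def)

lemma fps_cong_add: "fps_cong D f g \<Longrightarrow> fps_cong D f' g' \<Longrightarrow> fps_cong D (f + f') (g + g')"
  by (simp add: fps_cong_def)

lemma fps_cong_mult: "fps_cong D f g \<Longrightarrow> fps_cong D f' g' \<Longrightarrow> fps_cong D (f * f') (g * g')"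
  by (simp add: fps_cong_def fps_mult_nth)

lemma fps_cong_sum:
  "(\<And>x. x \<in> A \<Longrightarrow> fps_cong D (f x) (g x)) \<Longrightarrow> fps_cong D (sum f A) (sum g A)"
  by (simp add: fps_cong_def fps_sum_nth)

lemma fps_cong_prod_1:
  assumes "\<And>x. x \<in> A \<Longrightarrow> fps_cong D (f x) 1"
  shows "fps_cong D (prod f A) 1"
  using assms
proof (induction A rule: infinite_finite_induct)
  case (insert x A)
  then have "fps_cong D (f x * prod f A) (1 * 1)"
    by (intro fps_cong_mult) auto
  with insert.hyps show ?case by simp
qed auto

lemma fps_cong_mult_cancel:
  assumes "fps_cong D (f * u) (g * u)" and "fps_nth u 0 = 1"
  shows "fps_cong D f g"
proof -
  obtain v where v: "u * v = 1"
    using fps_right_inverse[of u 1] assms(2) by auto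
  have "fps_cong D (f * u * v) (g * u * v)"
    by (rule fps_cong_mult[OF assms(1) fps_cong_refl])
  then show ?thesis
    by (simp add: mult.assoc v)
qed

lemma fps_cong_power_0:
  assumes "fps_nth f 0 = 0" and "D < n"
  shows "fps_cong D (f ^ n) 0"
  using startsby_zero_power_prefix[OF assms(1), of n] assms(2) by (simp add: fps_cong_def)

lemma fps_cong_1_minus_power:
  assumes "fps_nth f 0 = 0" and "D < n"
  shows "fps_cong D (1 - f ^ n) 1"
  using fps_cong_power_0[OF assms] by (simp add: fps_cong_def)

section \<open>The triple product and the even part of a theta function\<close>

text \<open>
  The Gaussian binomial tends to \<open>1 / (p; p)\<^sub>\<infinity>\<close> when both \<open>k\<close> and \<open>n - k\<close> grow: in the
  factorial formula, the numerator only has factors \<open>1 - p\<^bsup>i\<^esup>\<close> with \<open>i > n - k \<ge> D\<close>.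
\<close>

lemma fps_cong_qbinom:
  fixes p :: "'a::comm_ring_1 fps"
  assumes p: "fps_nth p 0 = 0" and "D \<le> k" "k \<le> n" "D \<le> n - k" "D \<le> K"
  shows "fps_cong D (qbinom p n k * (\<Prod>i=1..K. 1 - p ^ i)) 1"
proof -
  have euler: "fps_cong D (\<Prod>i=1..L. 1 - p ^ i) (\<Prod>i=1..D. 1 - p ^ i)" if "D \<le> L" for L
  proof -
    have "(\<Prod>i=1..L. 1 - p ^ i) = (\<Prod>i=1..D. 1 - p ^ i) * (\<Prod>i=Suc D..L. 1 - p ^ i)"
      using that prod.ub_add_nat[of 1 D "\<lambda>i. 1 - p ^ i" "L - D"] by simp
    moreover have "fps_cong D (\<Prod>i=Suc D..L. 1 - p ^ i) 1"
      by (intro fps_cong_prod_1 fps_cong_1_minus_power p) auto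
    ultimately show ?thesis
      using fps_cong_mult[OF fps_cong_refl] by (metis mult.right_neutral)
  qed
  have "fps_cong D (\<Prod>i=1..K. 1 - p ^ i) (\<Prod>i=1..k. 1 - p ^ i)"
    using euler[OF \<open>D \<le> K\<close>] euler[OF \<open>D \<le> k\<close>] fps_cong_sym fps_cong_trans by blast
  then have "fps_cong D (qbinom p n k * (\<Prod>i=1..K. 1 - p ^ i))
      (qbinom p n k * (\<Prod>i=1..k. 1 - p ^ i))"
    by (intro fps_cong_mult) auto
  also have "qbinom p n k * (\<Prod>i=1..k. 1 - p ^ i) = (\<Prod>i<k. 1 - p ^ (n - i))"
    by (rule qbinom_mult_qfact) fact
  also have "fps_cong D \<dots> 1"
    using assms by (intro fps_cong_prod_1 fps_cong_1_minus_power p) auto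
  finally show ?thesis .
qed

text \<open>
  Hence \<open>theta_term a b j\<close> has order at least \<open>\<bar>j\<bar>\<close> when \<open>a\<close> and \<open>b\<close> have zero constant
  coefficient.
\<close>

lemma abs_le_tri: "\<bar>j\<bar> \<le> int (max (tri j) (tri (j - 1)))"
proof (cases "0 \<le> j")
  case True
  then have "2 * j \<le> j * (j + 1)"
    by (cases "j = 0") (auto intro!: mult_mono simp: mult.commute)
  then show ?thesis
    using two_tri[of j] True by linarith
next
  case False
  then have "2 * (- j) \<le> (1 - j) * (- j)"
    by (intro mult_right_mono) auto
  then have "2 * (- j) \<le> (j - 1) * (j - 1 + 1)"
    by (simp add: algebra_simps)
  then show ?thesis
    using two_tri[of "j - 1"] False by linarith
qed

lemma fps_cong_theta_term_0:
  fixes a b :: "'a::comm_ring_1 fps"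
  assumes "fps_nth a 0 = 0" "fps_nth b 0 = 0" "int D < \<bar>j\<bar>"
  shows "fps_cong D (theta_term a b j) 0"
proof -
  have "D < tri j \<or> D < tri (j - 1)"
    using abs_le_tri[of j] assms(3) by linarith
  then have "fps_cong D (a ^ tri j) 0 \<or> fps_cong D (b ^ tri (j - 1)) 0"
    using assms fps_cong_power_0 by blast
  then have "fps_cong D (theta_term a b j) (0 * b ^ tri (j - 1))
      \<or> fps_cong D (theta_term a b j) (a ^ tri j * 0)"
    unfolding theta_term_def using fps_cong_mult fps_cong_refl by blast
  then show ?thesis by simp
qed

text \<open>
  The finite triple product with \<open>m = n = N\<close>, multiplied by the Euler product in \<open>a b\<close>. For
  \<open>\<bar>j\<bar> \<le> D\<close> the Gaussian binomial and the Euler product cancel modulo \<open>X\<^bsup>D+1\<^esup>\<close>, and for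
  \<open>\<bar>j\<bar> > D\<close> the term itself vanishes. This is why the range \<open>J\<close> of the sum is arbitrary beyond \<open>D\<close>.
\<close>

lemma jacobi_triple_product_mod:
  fixes a b :: "'a::comm_ring_1 fps"
  assumes a: "fps_nth a 0 = 0" and b: "fps_nth b 0 = 0"
    and N: "2 * D \<le> N" and K: "D \<le> K" and J: "D \<le> J"
  shows "fps_cong D
    ((\<Prod>i<N. 1 + a * (a * b) ^ i) * (\<Prod>i<N. 1 + b * (a * b) ^ i) * (\<Prod>i=1..K. 1 - (a * b) ^ i))
    (\<Sum>j\<in>{- int J..int J}. theta_term a b j)"
proof -
  define p where "p = a * b"
  define E where "E = (\<Prod>i=1..K. 1 - p ^ i)"
  define \<theta> where "\<theta> = theta_term a b"
  define t where "t j = (if \<bar>j\<bar> \<le> int D then \<theta> j else 0)" for j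
  have p: "fps_nth p 0 = 0"
    using a by (simp add: p_def)
  have cut: "fps_cong D (\<theta> j * c) (t j)" if "\<bar>j\<bar> \<le> int D \<Longrightarrow> fps_cong D c 1" for j c
  proof (cases "\<bar>j\<bar> \<le> int D")
    case True
    then have "fps_cong D (\<theta> j * c) (\<theta> j * 1)"
      using that by (intro fps_cong_mult) auto
    then show ?thesis
      using True by (simp add: t_def)
  next
    case False
    then have "fps_cong D (\<theta> j * c) (0 * c)"
      unfolding \<theta>_def using a b by (intro fps_cong_mult fps_cong_theta_term_0) auto
    then show ?thesis
      using False by (simp add: t_def)
  qed
  have sum_t: "(\<Sum>j\<in>{- int L..int L}. t j) = (\<Sum>j\<in>{- int D..int D}. t j)" if "D \<le> L" for L
    using that by (intro sum.mono_neutral_right) (auto simp: t_def)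
  have "(\<Prod>i<N. 1 + a * p ^ i) * (\<Prod>i<N. 1 + b * p ^ i) * E
      = (\<Sum>k\<le>N + N. \<theta> (int k - int N) * (qbinom p (N + N) k * E))"
    using finite_jacobi_triple_product[of a b N N]
    by (simp add: p_def \<theta>_def sum_distrib_right mult.assoc)
  also have "\<dots> = (\<Sum>j\<in>{- int N..int N}. \<theta> j * (qbinom p (N + N) (nat (j + int N)) * E))"
    by (rule sum.reindex_bij_witness[of _ "\<lambda>j. nat (j + int N)" "\<lambda>k. int k - int N"]) auto
  also have "fps_cong D \<dots> (\<Sum>j\<in>{- int N..int N}. t j)"
    unfolding E_def using N K by (intro fps_cong_sum cut fps_cong_qbinom p) auto
  also have "\<dots> = (\<Sum>j\<in>{- int J..int J}. t j)"
    using sum_t[of N] sum_t[of J] N J by simp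
  also have "fps_cong D \<dots> (\<Sum>j\<in>{- int J..int J}. \<theta> j)"
    using cut[of _ 1] by (intro fps_cong_sum fps_cong_sym[of _ _ "t _"]) simp
  finally show ?thesis
    unfolding p_def E_def \<theta>_def .
qed

lemma theta_term_double: "theta_term a b (2 * i) = theta_term (a ^ 3 * b) (a * b ^ 3) i"
proof -
  have "int (tri (2 * i)) = int (3 * tri i + tri (i - 1))"
    using two_tri[of "2 * i"] two_tri[of i] two_tri[of "i - 1"] by (simp add: algebra_simps)
  moreover have "int (tri (2 * i - 1)) = int (tri i + 3 * tri (i - 1))"
    using two_tri[of "2 * i - 1"] two_tri[of i] two_tri[of "i - 1"] by (simp add: algebra_simps)
  ultimately have "tri (2 * i) = 3 * tri i + tri (i - 1)"
      and "tri (2 * i - 1) = tri i + 3 * tri (i - 1)"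
    by linarith+
  then show ?thesis
    by (simp add: theta_term_def power_mult_distrib power_add mult_ac flip: power_mult)
qed

lemma theta_term_minus_minus:
  "theta_term (- a) (- b) j = (if even j then theta_term a b j else - theta_term a b j)"
proof -
  have "2 * int (tri j + tri (j - 1)) = 2 * (j * j)"
    using two_tri[of j] two_tri[of "j - 1"] by (simp add: algebra_simps)
  then have "int (tri j + tri (j - 1)) = j * j"
    by simp
  then have "even (tri j + tri (j - 1)) \<longleftrightarrow> even j"
    by (metis even_of_nat even_mult_iff)
  then show ?thesis
    by (auto simp: theta_term_def power_minus[of a] power_minus[of b] minus_one_power_iff)
qed

text \<open>
  Replacing \<open>(a, b)\<close> by \<open>(-a, -b)\<close> multiplies the term with index \<open>j\<close> by \<open>(-1)\<^bsup>j\<^esup>\<close>, so that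
  \<open>f(a, b) + f(-a, -b)\<close> is twice the sum over the even indices. By \<open>theta_term_double\<close>, this sum
  is \<open>f(a\<^sup>3 b, a b\<^sup>3)\<close>, and the triple product turns all three theta functions into products.
\<close>

lemma theta_even_part_mod:
  fixes a b :: "'a::comm_ring_1 fps"
  assumes a: "fps_nth a 0 = 0" and b: "fps_nth b 0 = 0"
    and N: "2 * D \<le> N" and K: "D \<le> K" and N': "2 * D \<le> N'" and K': "D \<le> K'"
  defines "p \<equiv> a * b"
  shows "fps_cong D
    (((\<Prod>i<N. 1 + a * p ^ i) * (\<Prod>i<N. 1 + b * p ^ i)
      + (\<Prod>i<N. 1 - a * p ^ i) * (\<Prod>i<N. 1 - b * p ^ i)) * (\<Prod>i=1..K. 1 - p ^ i))
    (2 * ((\<Prod>i<N'. 1 + a ^ 3 * b * (p ^ 4) ^ i) * (\<Prod>i<N'. 1 + a * b ^ 3 * (p ^ 4) ^ i)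
      * (\<Prod>i=1..K'. 1 - (p ^ 4) ^ i)))"
proof -
  \<comment> \<open>Bound \<open>2 * D\<close>: the even indices in this range are the doubles of \<open>-D, ..., D\<close>.\<close>
  let ?J = "{- int (2 * D)..int (2 * D)}"
  have p': "a ^ 3 * b * (a * b ^ 3) = p ^ 4"
    by (simp add: p_def power_mult_distrib power3_eq_cube power4_eq_xxxx mult_ac)
  have "fps_cong D
      ((\<Prod>i<N. 1 + a * p ^ i) * (\<Prod>i<N. 1 + b * p ^ i) * (\<Prod>i=1..K. 1 - p ^ i)
        + (\<Prod>i<N. 1 - a * p ^ i) * (\<Prod>i<N. 1 - b * p ^ i) * (\<Prod>i=1..K. 1 - p ^ i))
      ((\<Sum>j\<in>?J. theta_term a b j) + (\<Sum>j\<in>?J. theta_term (- a) (- b) j))"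
    using jacobi_triple_product_mod[OF a b N K, of "2 * D"]
      jacobi_triple_product_mod[of "- a" "- b" D N K "2 * D"] a b N K
    unfolding p_def by (intro fps_cong_add) simp_all
  also have "(\<Sum>j\<in>?J. theta_term a b j) + (\<Sum>j\<in>?J. theta_term (- a) (- b) j)
      = (\<Sum>j\<in>?J. if even j then 2 * theta_term a b j else 0)"
    unfolding sum.distrib[symmetric] by (intro sum.cong) (auto simp: theta_term_minus_minus)
  also have "\<dots> = (\<Sum>j | j \<in> ?J \<and> even j. 2 * theta_term a b j)"
    by (rule sum.inter_filter[symmetric]) simp
  also have "\<dots> = (\<Sum>i\<in>{- int D..int D}. 2 * theta_term a b (2 * i))"
    by (rule sum.reindex_bij_witness[of _ "\<lambda>i. 2 * i" "\<lambda>j. j div 2"]) auto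
  also have "\<dots> = 2 * (\<Sum>i\<in>{- int D..int D}. theta_term (a ^ 3 * b) (a * b ^ 3) i)"
    by (simp add: theta_term_double sum_distrib_left)
  also have "fps_cong D \<dots>
     (2 * ((\<Prod>i<N'. 1 + a ^ 3 * b * (p ^ 4) ^ i) * (\<Prod>i<N'. 1 + a * b ^ 3 * (p ^ 4) ^ i)
      * (\<Prod>i=1..K'. 1 - (p ^ 4) ^ i)))"
    using jacobi_triple_product_mod[of "a ^ 3 * b" "a * b ^ 3" D N' K' D] a b N' K'
    unfolding p' by (intro fps_cong_mult[OF fps_cong_refl fps_cong_sym]) simp
  finally show ?thesis
    by (simp add: distrib_right)
qed

section \<open>Generating functions of multisets\<close>

text \<open>
  Partitions whose parts come in kinds: a part of kind \<open>x\<close> contributes \<open>w x\<close> to the sum.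
\<close>

definition weighted_multisets :: "'k set \<Rightarrow> ('k \<Rightarrow> nat) \<Rightarrow> nat \<Rightarrow> 'k multiset set" where
  "weighted_multisets A w n = {P. set_mset P \<subseteq> A \<and> (\<Sum>x\<in>#P. w x) = n}"

lemma finite_weighted_multisets:
  assumes "finite A" and "\<And>x. x \<in> A \<Longrightarrow> 0 < w x"
  shows "finite (weighted_multisets A w n)"
proof (rule finite_subset)
  have "size P \<le> (\<Sum>x\<in>#P. w x)" if "set_mset P \<subseteq> A" for P
    using that
  proof (induction P)
    case (add x P)
    then show ?case using assms(2)[of x] by simp
  qed simp
  then show "weighted_multisets A w n \<subseteq> (\<Union>m\<le>n. multisets_of_size A m)"
    by (auto simp: weighted_multisets_def multisets_of_size_def)
  show "finite (\<Union>m\<le>n. multisets_of_size A m)"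
    using assms(1) by auto
qed

definition multiset_gf :: "('k \<Rightarrow> 'a::comm_ring_1) \<Rightarrow> 'k set \<Rightarrow> ('k \<Rightarrow> nat) \<Rightarrow> 'a fps" where
  "multiset_gf c A w = Abs_fps (\<lambda>n. \<Sum>P\<in>weighted_multisets A w n. \<Prod>x\<in>#P. c x)"

text \<open>
  A multiset that contains \<open>a\<close> arises from exactly one smaller multiset by adding one copy of
  \<open>a\<close>, so the generating functions \<open>G'\<close> with and \<open>G\<close> without the kind \<open>a\<close> satisfy
  \<open>G' = G + c a * X\<^bsup>w a\<^esup> * G'\<close>.
\<close>

lemma multiset_gf_insert:
  assumes "finite A" "a \<notin> A" and w: "\<And>x. x \<in> insert a A \<Longrightarrow> 0 < w x"
  shows "multiset_gf c (insert a A) w * (1 - fps_const (c a) * fps_X ^ w a) = multiset_gf c A w"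
proof (rule fps_ext)
  fix n
  define W where "W = weighted_multisets (insert a A) w"
  define f where "f P = (\<Prod>x\<in>#P. c x)" for P
  have fin: "finite (W m)" for m
    unfolding W_def using assms by (intro finite_weighted_multisets) auto
  have split: "W n = weighted_multisets A w n \<union> {P \<in> W n. a \<in># P}"
    using assms(2) by (auto simp: W_def weighted_multisets_def)
  have with_a: "(\<Sum>P | P \<in> W n \<and> a \<in># P. f P) = (if n < w a then 0 else c a * (\<Sum>P\<in>W (n - w a). f P))"
  proof (cases "n < w a")
    case True
    have "w a \<le> (\<Sum>x\<in>#P. w x)" if "a \<in># P" for P
      using multi_member_split[OF that] by auto
    then have empty: "{P \<in> W n. a \<in># P} = {}"
      using True by (fastforce simp: W_def weighted_multisets_def)
    show ?thesis
      unfolding empty using True by simp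
  next
    case False
    have "(\<Sum>P | P \<in> W n \<and> a \<in># P. f P) = (\<Sum>P\<in>W (n - w a). f (add_mset a P))"
    proof (rule sum.reindex_bij_witness[of _ "add_mset a" "\<lambda>P. P - {#a#}"])
      fix P assume "P \<in> {P \<in> W n. a \<in># P}"
      then show "P - {#a#} \<in> W (n - w a)"
        using multi_member_split[of a P] by (auto simp: W_def weighted_multisets_def)
    qed (use False in \<open>auto simp: W_def weighted_multisets_def\<close>)
    also have "\<dots> = c a * (\<Sum>P\<in>W (n - w a). f P)"
      by (simp add: f_def sum_distrib_left)
    finally show ?thesis
      using False by simp
  qed
  have "(\<Sum>P\<in>W n. f P) = (\<Sum>P\<in>weighted_multisets A w n. f P) + (\<Sum>P | P \<in> W n \<and> a \<in># P. f P)"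
    using fin[of n] assms(2)
    by (subst split, intro sum.union_disjoint finite_weighted_multisets)
      (use assms in \<open>auto simp: weighted_multisets_def\<close>)
  then show "fps_nth (multiset_gf c (insert a A) w * (1 - fps_const (c a) * fps_X ^ w a)) n
      = fps_nth (multiset_gf c A w) n"
    using with_a unfolding multiset_gf_def W_def f_def
    by (simp add: right_diff_distrib fps_X_power_mult_right_nth flip: mult.assoc)
qed

text \<open>
  The usual product formula \<open>\<Prod> 1 / (1 - c X\<^bsup>w\<^esup>)\<close>, written without division so that the
  coefficients may lie in any commutative ring.
\<close>

lemma multiset_gf_mult_prod:
  assumes "finite A" and "\<And>x. x \<in> A \<Longrightarrow> 0 < w x"
  shows "multiset_gf c A w * (\<Prod>x\<in>A. 1 - fps_const (c x) * fps_X ^ w x) = 1"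
  using assms
proof (induction A rule: finite_induct)
  case empty
  have "weighted_multisets {} w n = (if n = 0 then {{#}} else {})" for n
    by (auto simp: weighted_multisets_def)
  then show ?case
    by (auto simp: multiset_gf_def fps_eq_iff)
next
  case (insert a A)
  then show ?case
    using multiset_gf_insert[of A a w c] by (simp flip: mult.assoc)
qed

section \<open>Generating functions of the two kinds of partitions\<close>

text \<open>
  Parts of size at most \<open>M\<close>: blue without restriction, red if the size satisfies \<open>R\<close>. Bounding
  the sizes keeps all products finite and loses nothing for partitions of \<open>n \<le> M\<close>.
\<close>

definition part_kinds :: "nat \<Rightarrow> (nat \<Rightarrow> bool) \<Rightarrow> (nat \<times> color) set" where
  "part_kinds M R = {1..M} \<times> {Blue} \<union> {m \<in> {1..M}. R m} \<times> {Red}"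

lemma in_part_kinds_iff: "(m, c) \<in> part_kinds M R \<longleftrightarrow> m \<in> {1..M} \<and> (c = Blue \<or> R m)"
  by (cases c) (auto simp: part_kinds_def)

lemma finite_part_kinds: "finite (part_kinds M R)"
  by (simp add: part_kinds_def)

lemma prod_part_kinds:
  "(\<Prod>x\<in>part_kinds M R. f x) = (\<Prod>m\<in>{1..M}. f (m, Blue)) * (\<Prod>m | m \<in> {1..M} \<and> R m. f (m, Red))"
proof -
  have "prod f (S \<times> {c}) = (\<Prod>m\<in>S. f (m, c))" for S :: "nat set" and c
    by (rule prod.reindex_bij_witness[of _ "\<lambda>m. (m, c)" fst]) auto
  then show ?thesis
    unfolding part_kinds_def by (subst prod.union_disjoint) auto
qed

lemma part_gf_mult_prod:
  "multiset_gf c (part_kinds M R) fst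
    * ((\<Prod>m\<in>{1..M}. 1 - fps_const (c (m, Blue)) * fps_X ^ m)
      * (\<Prod>m | m \<in> {1..M} \<and> R m. 1 - fps_const (c (m, Red)) * fps_X ^ m)) = 1"
  using multiset_gf_mult_prod[OF finite_part_kinds[of M R], of fst c]
  by (auto simp: prod_part_kinds in_part_kinds_iff)

lemma part_le_sum:
  fixes P :: "(nat \<times> color) multiset"
  shows "x \<in># P \<Longrightarrow> fst x \<le> (\<Sum>y\<in>#P. fst y)"
  by (drule multi_member_split) auto

lemma two_color_partition_eq:
  assumes "n \<le> M"
  shows "{P. two_color_partition n P \<and> (\<forall>m c. (m, c) \<in># P \<longrightarrow> c = Blue \<or> R m)}
    = weighted_multisets (part_kinds M R) fst n"
proof -
  have "(\<forall>x\<in>#P. fst x > 0) \<and> (\<forall>m c. (m, c) \<in># P \<longrightarrow> c = Blue \<or> R m)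
      \<longleftrightarrow> set_mset P \<subseteq> part_kinds M R" if "(\<Sum>x\<in>#P. fst x) = n" for P
  proof -
    have "\<forall>x\<in>#P. fst x \<le> M"
      using part_le_sum[of _ P] assms that by force
    then show ?thesis
      by (auto simp: in_part_kinds_iff Suc_le_eq subset_iff)
  qed
  then show ?thesis
    unfolding two_color_partition_def weighted_multisets_def by blast
qed

text \<open>
  The sign that makes the product over all parts equal to \<open>(-1)\<^bsup>r\<^esup>\<close>, with \<open>r\<close> the number of
  red odd parts. Averaging the signed and the unsigned count selects even \<open>r\<close>.
\<close>

definition red_odd_sign :: "nat \<times> color \<Rightarrow> int" where
  "red_odd_sign x = (if snd x = Red \<and> odd (fst x) then -1 else 1)"

lemma prod_red_odd_sign: "(\<Prod>x\<in>#P. red_odd_sign x) = (-1) ^ num_red_odd P"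
  by (induction P) (auto simp: red_odd_sign_def num_red_odd_def)

lemma F0_gf:
  assumes "n \<le> M"
  shows "2 * int (F0 n) = fps_nth (multiset_gf (\<lambda>_. 1) (part_kinds M odd) fst
    + multiset_gf red_odd_sign (part_kinds M odd) fst) n"
proof -
  have F: "F_set n = weighted_multisets (part_kinds M odd) fst n"
    unfolding two_color_partition_eq[OF assms, symmetric] F_set_def by blast
  have fin: "finite (F_set n)"
    unfolding F by (intro finite_weighted_multisets finite_part_kinds) (auto simp: in_part_kinds_iff)
  have "2 * int (F0 n) = (\<Sum>P | P \<in> F_set n \<and> even (num_red_odd P). 2)"
    by (simp add: F0_def)
  also have "\<dots> = (\<Sum>P\<in>F_set n. if even (num_red_odd P) then 2 else 0)"
    using fin by (simp only: sum.inter_filter)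
  also have "\<dots> = (\<Sum>P\<in>F_set n. 1 + (-1) ^ num_red_odd P)"
    by (intro sum.cong) auto
  finally show ?thesis
    by (simp add: multiset_gf_def F sum.distrib prod_red_odd_sign)
qed

text \<open>
  Detaching the overlined copies splits an overlined partition into a set \<open>S\<close> of sizes and an
  ordinary two-color partition \<open>Q\<close> of the rest. There is no constraint between \<open>S\<close> and
  \<open>Q\<close>, because the detached copy itself guarantees that its size occurs in blue.
\<close>

lemma overlined_partitions_bij:
  assumes "n \<le> M"
  defines "T \<equiv> {m \<in> {1..M}. m mod 16 \<in> {6, 10}}"
  shows "bij_betw (\<lambda>(S, Q). (Q + image_mset (\<lambda>m. (m, Blue)) (mset_set S), S))
    (SIGMA S:{S \<in> Pow T. \<Sum>S \<le> n}.
      weighted_multisets (part_kinds M (\<lambda>m. even m \<and> m mod 16 \<noteq> 0)) fst (n - \<Sum>S))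
    (overlined_partitions n)"
proof -
  define R where "R m \<longleftrightarrow> even m \<and> m mod 16 \<noteq> 0" for m :: nat
  define B :: "nat set \<Rightarrow> (nat \<times> color) multiset"
    where "B S = image_mset (\<lambda>m. (m, Blue)) (mset_set S)" for S
  have finT: "finite S" if "S \<subseteq> T" for S
    using that finite_subset unfolding T_def by fastforce
  have set_B: "set_mset (B S) = (\<lambda>m. (m, Blue)) ` S" if "S \<subseteq> T" for S
    using finT[OF that] by (simp add: B_def)
  have sum_B: "(\<Sum>x\<in>#B S. fst x) = \<Sum>S" for S
    by (simp add: B_def multiset.map_comp comp_def sum_unfold_sum_mset)
  have colours: "((m, c) \<in># P \<and> (odd m \<or> m mod 16 = 0) \<longrightarrow> c = Blue)
      \<longleftrightarrow> ((m, c) \<in># P \<longrightarrow> c = Blue \<or> even m \<and> m mod 16 \<noteq> 0)"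
    for m c and P :: "(nat \<times> color) multiset"
    by (cases "c = Blue"; cases "even m") simp_all
  have O: "overlined_partitions n = {(P, S). P \<in> weighted_multisets (part_kinds M R) fst n
      \<and> S \<subseteq> {m. (m, Blue) \<in># P \<and> m mod 16 \<in> {6, 10}}}"
    unfolding two_color_partition_eq[OF assms(1), symmetric] overlined_partitions_def R_def
    by (simp only: colours mem_Collect_eq conj_assoc)
  have sub: "S \<subseteq> T \<and> B S \<subseteq># P" if "(P, S) \<in> overlined_partitions n" for P S
  proof
    show ST: "S \<subseteq> T"
      using that by (auto simp: O T_def weighted_multisets_def in_part_kinds_iff subset_iff)
    have "mset_set ((\<lambda>m. (m, Blue)) ` S) \<subseteq># P"
      using that finT[OF ST] unfolding O
      by (intro mset_subset_eqI) (auto simp: count_mset_set' Suc_le_eq)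
    then show "B S \<subseteq># P"
      unfolding B_def by (simp add: image_mset_mset_set inj_on_def)
  qed
  show ?thesis
    unfolding R_def[symmetric] B_def[symmetric]
  proof (rule bij_betwI[where g = "\<lambda>(P, S). (S, P - B S)"], goal_cases)
    case 1
    show ?case
    proof (rule Pi_I)
      fix x
      assume "x \<in> (SIGMA S:{S \<in> Pow T. \<Sum>S \<le> n}.
        weighted_multisets (part_kinds M R) fst (n - \<Sum>S))"
      then obtain S Q where x: "x = (S, Q)" and S: "S \<in> Pow T" "\<Sum>S \<le> n"
        and Q: "Q \<in> weighted_multisets (part_kinds M R) fst (n - \<Sum>S)"
        by blast
      have "set_mset (B S) \<subseteq> part_kinds M R" "S \<subseteq> {m. m mod 16 \<in> {6, 10}}"
        using S(1) by (auto simp: set_B in_part_kinds_iff T_def)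
      then show "(case x of (S, Q) \<Rightarrow> (Q + B S, S)) \<in> overlined_partitions n"
        using S Q by (auto simp: x O weighted_multisets_def set_B sum_B)
    qed
  next
    case 2
    show ?case
    proof (rule Pi_I)
      fix x assume "x \<in> overlined_partitions n"
      then obtain P S where x: "x = (P, S)" and PS: "(P, S) \<in> overlined_partitions n"
        by (cases x) blast
      obtain Q where Q: "P = B S + Q"
        using sub[OF PS] subset_mset.le_iff_add by blast
      then have "(\<Sum>x\<in>#Q. fst x) + \<Sum>S = n" "set_mset Q \<subseteq> part_kinds M R"
        using PS by (auto simp: O weighted_multisets_def sum_B)
      then show "(case x of (P, S) \<Rightarrow> (S, P - B S)) \<in> (SIGMA S:{S \<in> Pow T. \<Sum>S \<le> n}.
          weighted_multisets (part_kinds M R) fst (n - \<Sum>S))"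
        using sub[OF PS] Q by (auto simp: x weighted_multisets_def)
    qed
  next
    case 3
    then show ?case by auto
  next
    case (4 y)
    then show ?case using sub by (cases y) auto
  qed
qed

lemma overlined_partitions_gf:
  assumes "n \<le> M"
  shows "int (card (overlined_partitions n))
    = fps_nth ((\<Prod>m | m \<in> {1..M} \<and> m mod 16 \<in> {6, 10}. 1 + fps_X ^ m)
        * multiset_gf (\<lambda>_. 1) (part_kinds M (\<lambda>m. even m \<and> m mod 16 \<noteq> 0)) fst) n"
proof -
  define T where "T = {m \<in> {1..M}. m mod 16 \<in> {6, 10}}"
  define K where "K = part_kinds M (\<lambda>m. even m \<and> m mod 16 \<noteq> 0)"
  define G :: "int fps" where "G = multiset_gf (\<lambda>_. 1) K fst"
  have G: "fps_nth G k = int (card (weighted_multisets K fst k))" for k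
    by (simp add: G_def multiset_gf_def)
  have fin: "finite (weighted_multisets K fst k)" for k
    unfolding K_def by (intro finite_weighted_multisets finite_part_kinds) (auto simp: in_part_kinds_iff)
  have finT: "finite T" by (simp add: T_def)
  have "card (overlined_partitions n)
      = (\<Sum>S | S \<in> Pow T \<and> \<Sum>S \<le> n. card (weighted_multisets K fst (n - \<Sum>S)))"
    using bij_betw_same_card[OF overlined_partitions_bij[OF assms]] fin finT
    unfolding T_def K_def by simp
  then have "int (card (overlined_partitions n))
      = (\<Sum>S | S \<in> Pow T \<and> \<Sum>S \<le> n. fps_nth G (n - \<Sum>S))"
    by (simp add: G)
  also have "\<dots> = (\<Sum>S\<in>Pow T. if \<Sum>S \<le> n then fps_nth G (n - \<Sum>S) else 0)"
    using finT by (simp only: sum.inter_filter finite_Pow_iff)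
  also have "\<dots> = (\<Sum>S\<in>Pow T. fps_nth (fps_X ^ \<Sum>S * G) n)"
    by (intro sum.cong) (auto simp: fps_X_power_mult_nth)
  also have "\<dots> = fps_nth ((\<Prod>m\<in>T. fps_X ^ m + 1) * G) n"
    using prod_add[OF finT, of "\<lambda>m. fps_X ^ m :: int fps" "\<lambda>_. 1"]
    by (simp add: fps_sum_nth sum_distrib_right power_sum)
  finally show ?thesis
    by (simp add: T_def G_def K_def add.commute)
qed

section \<open>Products over residue classes\<close>

text \<open>
  The products in the triple product run over \<open>i < N\<close>; those in the generating functions run over
  the parts in residue classes.
\<close>

lemma prod_residue_class:
  fixes f :: "nat \<Rightarrow> 'a::comm_monoid_mult"
  assumes "0 < r" "r < d"
  shows "(\<Prod>m | m \<in> {1..d * N} \<and> m mod d = r. f m) = (\<Prod>i<N. f (d * i + r))"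
proof (rule prod.reindex_bij_witness[of _ "\<lambda>i. d * i + r" "\<lambda>m. m div d"])
  fix m assume m: "m \<in> {m. m \<in> {1..d * N} \<and> m mod d = r}"
  then have "d * (m div d) + r = m"
    using mult_div_mod_eq[of d m] by simp
  then show "d * (m div d) + r = m" "f (d * (m div d) + r) = f m" by simp_all
  have "m < d * N"
    using m assms by (cases "m = d * N") auto
  then show "m div d \<in> {..<N}"
    by (simp add: less_mult_imp_div_less mult.commute)
next
  fix i assume i: "i \<in> {..<N}"
  then have "d * Suc i \<le> d * N"
    by (intro mult_le_mono2) simp
  then show "d * i + r \<in> {m. m \<in> {1..d * N} \<and> m mod d = r}"
    using assms by simp
qed (use assms in auto)

lemma prod_multiples:
  fixes f :: "nat \<Rightarrow> 'a::comm_monoid_mult"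
  assumes "0 < d"
  shows "(\<Prod>m | m \<in> {1..d * N} \<and> m mod d = 0. f m) = (\<Prod>i=1..N. f (d * i))"
proof (rule prod.reindex_bij_witness[of _ "\<lambda>i. d * i" "\<lambda>m. m div d"])
  fix m assume m: "m \<in> {m. m \<in> {1..d * N} \<and> m mod d = 0}"
  then obtain i where "m = d * i" by auto
  with m assms show "d * (m div d) = m" "f (d * (m div d)) = f m" "m div d \<in> {1..N}"
    by auto
qed (use assms in auto)

lemma prod_filter_disj:
  assumes "finite A" and "\<And>m. m \<in> A \<Longrightarrow> R m \<longleftrightarrow> P m \<or> Q m" and "\<And>m. m \<in> A \<Longrightarrow> \<not> (P m \<and> Q m)"
  shows "(\<Prod>m | m \<in> A \<and> R m. f m) = (\<Prod>m | m \<in> A \<and> P m. f m) * (\<Prod>m | m \<in> A \<and> Q m. f m)"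
proof -
  have "{m. m \<in> A \<and> R m} = {m. m \<in> A \<and> P m} \<union> {m. m \<in> A \<and> Q m}"
    using assms by blast
  then show ?thesis
    using assms by (simp only: prod.union_disjoint[symmetric]) (subst prod.union_disjoint, auto)
qed

lemma odd_iff_mod_4: "odd m \<longleftrightarrow> m mod 4 = 1 \<or> m mod 4 = (3::nat)"
  by presburger

lemma prod_odd:
  fixes f :: "nat \<Rightarrow> 'a::comm_monoid_mult"
  shows "(\<Prod>m | m \<in> {1..4 * N} \<and> odd m. f m) = (\<Prod>i<N. f (4 * i + 1)) * (\<Prod>i<N. f (4 * i + 3))"
proof -
  have "(\<Prod>m | m \<in> {1..4 * N} \<and> odd m. f m)
      = (\<Prod>m | m \<in> {1..4 * N} \<and> m mod 4 = 1. f m) * (\<Prod>m | m \<in> {1..4 * N} \<and> m mod 4 = 3. f m)"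
    by (rule prod_filter_disj) (simp_all only: odd_iff_mod_4, auto)
  then show ?thesis
    by (simp only: prod_residue_class)
qed

text \<open>
  The heart of the theorem: \<open>theta_even_part_mod\<close> with \<open>a = X\<close> and \<open>b = X\<^sup>3\<close>, so that
  \<open>a b = X\<^sup>4\<close>, \<open>a\<^sup>3 b = X\<^sup>6\<close>, \<open>a b\<^sup>3 = X\<^sup>1\<^sup>0\<close> and \<open>(a b)\<^sup>4 = X\<^sup>1\<^sup>6\<close>. The bound \<open>32 n\<close> on the parts is
  \<open>16\<close> times the number \<open>2 n\<close> of factors that the triple product needs for precision \<open>n\<close>.
\<close>

lemma odd_partition_even_part_mod:
  fixes n :: nat
  defines "A \<equiv> {1..32 * n}"
  shows "fps_cong n
    (((\<Prod>m | m \<in> A \<and> odd m. 1 + fps_X ^ m) + (\<Prod>m | m \<in> A \<and> odd m. 1 - fps_X ^ m))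
      * (\<Prod>m | m \<in> A \<and> m mod 4 = 0. 1 - fps_X ^ m))
    (2 * ((\<Prod>m | m \<in> A \<and> m mod 16 \<in> {6, 10}. 1 + fps_X ^ m)
      * (\<Prod>m | m \<in> A \<and> m mod 16 = 0. 1 - fps_X ^ m)) :: 'a::comm_ring_1 fps)"
proof -
  let ?X = "fps_X :: 'a fps"
  have A4: "A = {1..4 * (8 * n)}" and A16: "A = {1..16 * (2 * n)}"
    by (simp_all add: A_def)
  have base: "?X * ?X ^ 3 = ?X ^ 4" "?X ^ 3 * ?X ^ 3 = ?X ^ 6" "?X * (?X ^ 3) ^ 3 = ?X ^ 10"
      "(?X ^ 4) ^ 4 = ?X ^ 16"
    by (simp_all flip: power_Suc power_mult power_add)
  have pow: "(?X ^ d) ^ i = ?X ^ (d * i)" "?X * ?X ^ (d * i) = ?X ^ (d * i + 1)"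
      "?X ^ r * ?X ^ (d * i) = ?X ^ (d * i + r)" for d r i
    by (simp_all add: power_add power_mult)
  have T: "(\<Prod>m | m \<in> A \<and> m mod 16 \<in> {6, 10}. 1 + ?X ^ m)
      = (\<Prod>i<2 * n. 1 + ?X ^ (16 * i + 6)) * (\<Prod>i<2 * n. 1 + ?X ^ (16 * i + 10))"
  proof -
    have "(\<Prod>m | m \<in> A \<and> m mod 16 \<in> {6, 10}. 1 + ?X ^ m)
      = (\<Prod>m | m \<in> A \<and> m mod 16 = 6. 1 + ?X ^ m) * (\<Prod>m | m \<in> A \<and> m mod 16 = 10. 1 + ?X ^ m)"
      by (rule prod_filter_disj) (auto simp: A_def)
    then show ?thesis
      unfolding A16 by (simp only: prod_residue_class)
  qed
  have odd: "(\<Prod>m | m \<in> A \<and> odd m. f m) = (\<Prod>i<8 * n. f (4 * i + 1)) * (\<Prod>i<8 * n. f (4 * i + 3))"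
    for f :: "nat \<Rightarrow> 'a fps"
    unfolding A4 by (rule prod_odd)
  have R4: "(\<Prod>m | m \<in> A \<and> m mod 4 = 0. 1 - ?X ^ m) = (\<Prod>i=1..8 * n. 1 - ?X ^ (4 * i))"
    unfolding A4 by (rule prod_multiples) simp
  have R16: "(\<Prod>m | m \<in> A \<and> m mod 16 = 0. 1 - ?X ^ m) = (\<Prod>i=1..2 * n. 1 - ?X ^ (16 * i))"
    unfolding A16 by (rule prod_multiples) simp
  show ?thesis
    using theta_even_part_mod[of ?X "?X ^ 3" n "8 * n" "8 * n" "2 * n" "2 * n"]
    unfolding base unfolding pow odd T R4 R16 by simp
qed

text \<open>
  Since \<open>(1 - X\<^bsup>m\<^esup>) (1 + X\<^bsup>m\<^esup>) = 1 - X\<^bsup>2m\<^esup>\<close>, the two products over odd \<open>m\<close> give the factors for the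
  sizes \<open>\<equiv> 2 (mod 4)\<close>, and together with the multiples of \<open>4\<close> these are all even sizes. It is a
  congruence only because some of the sizes \<open>2 m\<close> exceed the bound on the parts.
\<close>

lemma odd_products_mod:
  fixes n :: nat
  defines "A \<equiv> {1..32 * n}"
  shows "fps_cong n
    ((\<Prod>m | m \<in> A \<and> odd m. 1 - fps_X ^ m) * (\<Prod>m | m \<in> A \<and> odd m. 1 + fps_X ^ m)
      * (\<Prod>m | m \<in> A \<and> m mod 4 = 0. 1 - fps_X ^ m))
    ((\<Prod>m | m \<in> A \<and> even m \<and> m mod 16 \<noteq> 0. 1 - fps_X ^ m)
      * (\<Prod>m | m \<in> A \<and> m mod 16 = 0. 1 - fps_X ^ m) :: 'a::comm_ring_1 fps)"
proof -
  let ?f = "\<lambda>m. 1 - (fps_X :: 'a fps) ^ m"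
  have fin: "finite A" by (simp add: A_def)
  have "(\<Prod>m | m \<in> A \<and> odd m. ?f m) * (\<Prod>m | m \<in> A \<and> odd m. 1 + fps_X ^ m)
      = (\<Prod>m | m \<in> A \<and> odd m. ?f (2 * m))"
    unfolding prod.distrib[symmetric]
    by (intro prod.cong refl) (simp add: ring_distribs power_even_eq power2_eq_square)
  also have "\<dots> = (\<Prod>k | k \<in> {1..64 * n} \<and> k mod 4 = 2. ?f k)"
  proof (rule prod.reindex_bij_witness[of _ "\<lambda>k. k div 2" "\<lambda>m. 2 * m"], goal_cases)
    case (2 m)
    then have m: "m \<in> {1..32 * n}" "odd m"
      by (simp_all add: A_def)
    from m(2) have "(2 * m) mod 4 = 2"
      by presburger
    with m(1) show ?case by simp
  next
    case (3 k)
    then have "k mod 4 = 2" by simp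
    then show ?case by presburger
  next
    case (4 k)
    then have "k mod 4 = 2" "1 \<le> k" "k \<le> 64 * n" by simp_all
    moreover from this have "odd (k div 2)" "1 \<le> k div 2"
      by presburger+
    ultimately show ?case by (simp add: A_def)
  qed simp_all
  also have "\<dots> = (\<Prod>k | k \<in> A \<and> k mod 4 = 2. ?f k)
      * (\<Prod>k | k \<in> {32 * n<..64 * n} \<and> k mod 4 = 2. ?f k)"
  proof -
    have "{k. k \<in> {1..64 * n} \<and> k mod 4 = 2}
        = {k. k \<in> A \<and> k mod 4 = 2} \<union> {k. k \<in> {32 * n<..64 * n} \<and> k mod 4 = 2}"
      by (auto simp: A_def)
    then show ?thesis
      by (simp only:) (rule prod.union_disjoint, auto simp: A_def)
  qed
  also have "fps_cong n \<dots> ((\<Prod>k | k \<in> A \<and> k mod 4 = 2. ?f k) * 1)"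
  proof (rule fps_cong_mult[OF fps_cong_refl fps_cong_prod_1])
    fix k assume "k \<in> {k. k \<in> {32 * n<..64 * n} \<and> k mod 4 = 2}"
    then have "n < k" by simp
    then show "fps_cong n (?f k) 1"
      by (rule fps_cong_1_minus_power[rotated]) simp
  qed
  finally have "fps_cong n
      ((\<Prod>m | m \<in> A \<and> odd m. ?f m) * (\<Prod>m | m \<in> A \<and> odd m. 1 + fps_X ^ m)
        * (\<Prod>m | m \<in> A \<and> m mod 4 = 0. ?f m))
      ((\<Prod>k | k \<in> A \<and> k mod 4 = 2. ?f k) * 1 * (\<Prod>m | m \<in> A \<and> m mod 4 = 0. ?f m))"
    by (rule fps_cong_mult) simp
  also have "(\<Prod>k | k \<in> A \<and> k mod 4 = 2. ?f k) * 1 * (\<Prod>m | m \<in> A \<and> m mod 4 = 0. ?f m)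
      = (\<Prod>m | m \<in> A \<and> even m. ?f m)"
    unfolding mult_1_right by (rule prod_filter_disj[OF fin, symmetric]) presburger+
  also have "\<dots> = (\<Prod>m | m \<in> A \<and> even m \<and> m mod 16 \<noteq> 0. ?f m) * (\<Prod>m | m \<in> A \<and> m mod 16 = 0. ?f m)"
    by (rule prod_filter_disj[OF fin]) presburger+
  finally show ?thesis .
qed

section \<open>Equality of the two counts\<close>

theorem corollary1:
  fixes n :: nat
  shows "F0 n = card (overlined_partitions n)"
proof -
  define A where "A = {1..32 * n}"
  define G :: "int fps" where "G = multiset_gf (\<lambda>_. 1) (part_kinds (32 * n) odd) fst"
  define G' where "G' = multiset_gf red_odd_sign (part_kinds (32 * n) odd) fst"
  define H :: "int fps"
    where "H = multiset_gf (\<lambda>_. 1) (part_kinds (32 * n) (\<lambda>m. even m \<and> m mod 16 \<noteq> 0)) fst"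
  define all :: "int fps" where "all = (\<Prod>m\<in>A. 1 - fps_X ^ m)"
  define odds :: "int fps" where "odds = (\<Prod>m | m \<in> A \<and> odd m. 1 - fps_X ^ m)"
  define odds' :: "int fps" where "odds' = (\<Prod>m | m \<in> A \<and> odd m. 1 + fps_X ^ m)"
  define evens :: "int fps" where "evens = (\<Prod>m | m \<in> A \<and> even m \<and> m mod 16 \<noteq> 0. 1 - fps_X ^ m)"
  define fours :: "int fps" where "fours = (\<Prod>m | m \<in> A \<and> m mod 4 = 0. 1 - fps_X ^ m)"
  define sixteens :: "int fps" where "sixteens = (\<Prod>m | m \<in> A \<and> m mod 16 = 0. 1 - fps_X ^ m)"
  define T :: "int fps" where "T = (\<Prod>m | m \<in> A \<and> m mod 16 \<in> {6, 10}. 1 + fps_X ^ m)"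
  \<comment> \<open>A common denominator of the three generating functions. Its constant coefficient is \<open>1\<close>,
    so it may be cancelled at the end.\<close>
  define U where "U = all * odds * odds' * fours"
  have G: "G * (all * odds) = 1"
    using part_gf_mult_prod[of "\<lambda>_. 1 :: int" "32 * n" odd]
    by (simp add: G_def all_def odds_def A_def)
  have "(\<Prod>m | m \<in> A \<and> odd m. 1 - fps_const (red_odd_sign (m, Red)) * fps_X ^ m) = odds'"
    unfolding odds'_def by (intro prod.cong) (auto simp: red_odd_sign_def simp flip: fps_const_neg)
  then have G': "G' * (all * odds') = 1"
    using part_gf_mult_prod[of red_odd_sign "32 * n" odd]
    by (simp add: G'_def all_def A_def red_odd_sign_def)
  have H: "H * (all * evens) = 1"
    using part_gf_mult_prod[of "\<lambda>_. 1 :: int" "32 * n" "\<lambda>m. even m \<and> m mod 16 \<noteq> 0"]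
    by (simp add: H_def all_def evens_def A_def)
  have "(G + G') * U = (G * (all * odds)) * odds' * fours + (G' * (all * odds')) * odds * fours"
    by (simp add: U_def algebra_simps)
  also have "\<dots> = (odds' + odds) * fours"
    unfolding G G' by (simp add: algebra_simps)
  also have "fps_cong n \<dots> (2 * (T * sixteens))"
    unfolding odds_def odds'_def fours_def T_def sixteens_def A_def
    by (rule odd_partition_even_part_mod)
  also have "2 * (T * sixteens) = 2 * T * (H * (all * evens)) * sixteens"
    unfolding H by simp
  also have "\<dots> = 2 * T * H * all * (evens * sixteens)"
    by (simp add: algebra_simps)
  also have "fps_cong n \<dots> (2 * T * H * all * (odds * odds' * fours))"
    unfolding odds_def odds'_def fours_def evens_def sixteens_def A_def
    by (rule fps_cong_mult[OF fps_cong_refl fps_cong_sym[OF odd_products_mod]])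
  also have "2 * T * H * all * (odds * odds' * fours) = 2 * (T * H) * U"
    by (simp add: U_def algebra_simps)
  finally have "fps_cong n ((G + G') * U) (2 * (T * H) * U)" .
  moreover have "fps_nth U 0 = 1"
  proof -
    have "fps_cong 0 U (1 * 1 * 1 * 1)"
      unfolding U_def all_def odds_def odds'_def fours_def
      by (intro fps_cong_mult fps_cong_prod_1) (auto simp: fps_cong_def A_def)
    then show ?thesis
      by (simp add: fps_cong_def)
  qed
  ultimately have "fps_cong n (G + G') (2 * (T * H))"
    by (rule fps_cong_mult_cancel)
  then have "fps_nth (G + G') n = 2 * fps_nth (T * H) n"
    unfolding mult_2 by (simp only: fps_cong_def fps_add_nth le_refl)
  then have "2 * int (F0 n) = 2 * int (card (overlined_partitions n))"
    using F0_gf[of n "32 * n"] overlined_partitions_gf[of n "32 * n"]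
    unfolding G_def G'_def T_def H_def A_def by simp
  then show ?thesis by simp
qed

end
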